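(* Let $X$ be a separable metrizable space. Then $X$ is $\sigma$-compact if and only if $AM(X)$ is completely metrizable.
   Context: For a metrizable space $X$, $C(X^2)$ denotes the space of continuous bounded real-valued functions on $X^2 = X \times X$, with the topology induced by the sup-metric $D(f,g) = \sup\{|f(x,y) - g(x,y)| \mid (x,y) \in X^2\}$. A metric on $X$ is admissible if it induces the given topology of $X$. $AM(X)$ denotes the subspace of $C(X^2)$ consisting of all bounded admissible metrics on $X$. *)

theory Defs
  imports "HOL-Analysis.Analysis"
begin

definition sigma_compact_space :: "'a topology \<Rightarrow> bool" where
  "sigma_compact_space X \<longleftrightarrow>
     (\<exists>\<K>. countable \<K> \<and> (\<forall>K\<in>\<K>. compactin X K) \<and> \<Union>\<K> = topspace X)"

definition admissible_metric :: "'a topology \<Rightarrow> ('a \<Rightarrow> 'a \<Rightarrow> real) \<Rightarrow> bool" where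
  "admissible_metric X d \<longleftrightarrow>
     Metric_space (topspace X) d \<and> Metric_space.mtopology (topspace X) d = X"

definition C_square :: "'a topology \<Rightarrow> ('a \<times> 'a \<Rightarrow> real) metric" where
  "C_square X = cfunspace (prod_topology X X) euclidean_metric"

(* The elements of C_square X are extensional (equal to undefined off the square), whereas
   the locale Metric_space requires d to be nonnegative and symmetric on the whole type.
   A member of AM X is therefore the restriction to the square of such a d. *)
definition AM :: "'a topology \<Rightarrow> ('a \<times> 'a \<Rightarrow> real) set" where
  "AM X = {\<lambda>(x, y) \<in> topspace X \<times> topspace X. d x y | d.
     admissible_metric X d \<and> (\<exists>B. \<forall>x \<in> topspace X. \<forall>y \<in> topspace X. d x y \<le> B)}"

definition AM_space :: "'a topology \<Rightarrow> ('a \<times> 'a \<Rightarrow> real) topology" where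
  "AM_space X = subtopology (mtopology_of (C_square X)) (AM X)"

lemma mdist_C_square:
  assumes "f \<in> mspace (C_square X)" "g \<in> mspace (C_square X)" "topspace X \<noteq> {}"
  shows "mdist (C_square X) f g = (SUP p \<in> topspace X \<times> topspace X. \<bar>f p - g p\<bar>)"
  using assms
  by (auto simp: C_square_def mdist_cfunspace_eq_mdist_funspace Met_TC.fdist_def
      Met_TC.fspace_def dist_real_def)

lemma AM_subset_C_square: "AM X \<subseteq> mspace (C_square X)"
proof
  fix f assume "f \<in> AM X"
  then obtain d B where d: "admissible_metric X d"
    and B: "\<And>x y. x \<in> topspace X \<Longrightarrow> y \<in> topspace X \<Longrightarrow> d x y \<le> B"
    and f: "f = (\<lambda>(x, y) \<in> topspace X \<times> topspace X. d x y)"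
    by (auto simp: AM_def)
  interpret Metric_space "topspace X" d
    using d by (simp add: admissible_metric_def)
  have X: "mtopology = X"
    using d by (simp add: admissible_metric_def)
  have "continuous_map (prod_topology X X) euclidean (\<lambda>p. d (fst p) (snd p))"
    using continuous_map_metric[of Self]
    by (simp add: X mtopology_of_def case_prod_unfold)
  then have "continuous_map (prod_topology X X) euclidean f"
    by (rule continuous_map_eq) (auto simp: f)
  moreover have "bounded (f ` (topspace X \<times> topspace X))"
    unfolding bounded_iff using B by (intro exI[of _ B]) (auto simp: f)
  ultimately show "f \<in> mspace (C_square X)"
    by (simp add: C_square_def f)
qed

lemma topspace_AM_space: "topspace (AM_space X) = AM X"
  using AM_subset_C_square by (auto simp: AM_space_def)

end

theory Submission
  imports Defs
begin

text \<open>
  The space of bounded continuous functions on the square is complete, so a subspace of it is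
  completely metrizable iff it is a \<open>G\<^sub>\<delta>\<close> set. The theorem thus asks when \<open>AM X\<close> is
  \<open>G\<^sub>\<delta>\<close> in \<open>C_square X\<close>. A bounded continuous pseudometric \<open>f\<close> always induces a topology coarser
  than that of \<open>X\<close>; it is an admissible metric iff every open set is a neighbourhood of each of
  its points with respect to \<open>f\<close> (\<open>AM_eq\<close>).

  Let \<open>X\<close> be \<open>\<sigma>\<close>-compact and fix an admissible metric \<open>\<rho>\<close>. On a compact set \<open>K\<close> an admissible \<open>f\<close>
  refines \<open>\<rho>\<close> uniformly: for each \<open>k\<close> some \<open>\<delta> > 0\<close> is a lower bound of \<open>f (x, y)\<close> over all
  \<open>x \<in> K\<close> and \<open>y\<close> with \<open>\<rho> x y \<ge> 1 / (k + 1)\<close> (\<open>pseudometric_mem_separating_on\<close>). For fixed \<open>K\<close>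
  and \<open>k\<close> this condition is stable under small uniform perturbations, hence open. Imposing it for
  countably many \<open>K\<close> that cover \<open>X\<close> and for all \<open>k\<close> forces admissibility, so \<open>AM X\<close> is the
  intersection of the closed set of pseudometrics with countably many open sets
  (\<open>gdelta_in_AM\<close>).

  Conversely, embed \<open>X\<close> by \<open>e\<close> as a dense subset \<open>E\<close> of a compact metric space \<open>Y\<close>, and let
  \<open>p \<in> Y - E\<close>; if there is no such \<open>p\<close> then \<open>X\<close> is compact. For \<open>z \<in> Y\<close> pull back to \<open>X\<close>
  the quotient pseudometric of \<open>Y\<close> with \<open>z\<close> and \<open>p\<close> identified. If \<open>z \<notin> E\<close>, both glued points lie
  outside \<open>E\<close> and the topology of \<open>E\<close> is unchanged. If \<open>z \<in> E\<close>, points of \<open>E\<close> approaching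
  \<open>p\<close> now also approach \<open>z\<close>, and the pseudometric is not admissible
  (\<open>glued_pseudometric_in_AM_iff\<close>). As the pseudometric depends continuously on \<open>z\<close>, the set
  \<open>Y - E\<close> is the preimage of \<open>AM X\<close> under a continuous map. When \<open>AM X\<close> is \<open>G\<^sub>\<delta>\<close>, its
  complement \<open>E\<close> in the compact space \<open>Y\<close> is therefore a countable union of compact sets
  (\<open>sigma_compact_if_gdelta_AM\<close>).
\<close>

section \<open>Recognising admissible metrics\<close>

definition bounded_pseudometrics :: "'a topology \<Rightarrow> ('a \<times> 'a \<Rightarrow> real) set" where
  "bounded_pseudometrics X = {f \<in> mspace (C_square X).
     \<forall>x\<in>topspace X. \<forall>y\<in>topspace X. \<forall>z\<in>topspace X.
       f (x, x) = 0 \<and> f (x, y) = f (y, x) \<and> f (x, z) \<le> f (x, y) + f (y, z)}"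

definition balls_refine_topology :: "'a topology \<Rightarrow> ('a \<times> 'a \<Rightarrow> real) \<Rightarrow> bool" where
  "balls_refine_topology X f \<longleftrightarrow>
     (\<forall>U. \<forall>x\<in>U. openin X U \<longrightarrow> (\<exists>\<epsilon>>0. \<forall>y\<in>topspace X. f (x, y) < \<epsilon> \<longrightarrow> y \<in> U))"

lemma mspace_C_square:
  "f \<in> mspace (C_square X) \<longleftrightarrow>
     f \<in> extensional (topspace X \<times> topspace X) \<and> bounded (f ` (topspace X \<times> topspace X)) \<and>
     continuous_map (prod_topology X X) euclidean f"
  by (auto simp: C_square_def)

lemma openin_ball_C_square:
  assumes "f \<in> mspace (C_square X)" "x \<in> topspace X"
  shows "openin X {y \<in> topspace X. f (x, y) < r}"
proof -
  have "continuous_map X (prod_topology X X) (\<lambda>y. (x, y))"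
    using assms(2) by (simp add: continuous_map_pairwise o_def)
  from continuous_map_compose[OF this] assms(1)
  have "continuous_map X euclidean (\<lambda>y. f (x, y))"
    by (auto simp: mspace_C_square o_def)
  then have "openin X {y \<in> topspace X. f (x, y) \<in> {..<r}}"
    by (rule openin_continuous_map_preimage) simp
  then show ?thesis by simp
qed

lemma bounded_pseudometric_nonneg:
  assumes "f \<in> bounded_pseudometrics X" "x \<in> topspace X" "y \<in> topspace X"
  shows "0 \<le> f (x, y)"
proof -
  have "f (x, x) = 0" "f (x, y) = f (y, x)" "f (x, x) \<le> f (x, y) + f (y, x)"
    using assms unfolding bounded_pseudometrics_def by blast+
  then show ?thesis by linarith
qed

lemma AM_subset_bounded_pseudometrics: "AM X \<subseteq> bounded_pseudometrics X"
proof
  fix f assume f: "f \<in> AM X"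
  then obtain d where d: "admissible_metric X d"
    and fd: "f = (\<lambda>(x, y) \<in> topspace X \<times> topspace X. d x y)"
    by (auto simp: AM_def)
  interpret Metric_space "topspace X" d
    using d by (simp add: admissible_metric_def)
  show "f \<in> bounded_pseudometrics X"
    using f AM_subset_C_square by (auto simp: bounded_pseudometrics_def fd commute triangle)
qed

lemma AM_balls_refine_topology:
  assumes "f \<in> AM X"
  shows "balls_refine_topology X f"
proof -
  obtain d where d: "admissible_metric X d"
    and fd: "f = (\<lambda>(x, y) \<in> topspace X \<times> topspace X. d x y)"
    using assms by (auto simp: AM_def)
  interpret Metric_space "topspace X" d
    using d by (simp add: admissible_metric_def)
  have X: "mtopology = X"
    using d by (simp add: admissible_metric_def)
  show ?thesis
    unfolding balls_refine_topology_def
  proof (intro allI ballI impI)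
    fix U x assume "x \<in> U" "openin X U"
    then have "openin mtopology U" using X by simp
    with \<open>x \<in> U\<close> obtain r where r: "r > 0" "mball x r \<subseteq> U" and xX: "x \<in> topspace X"
      unfolding openin_mtopology by blast
    show "\<exists>\<epsilon>>0. \<forall>y\<in>topspace X. f (x, y) < \<epsilon> \<longrightarrow> y \<in> U"
      using r xX by (intro exI[of _ r]) (auto simp: fd subset_iff)
  qed
qed

text \<open>Continuity of \<open>f\<close> makes its balls open in \<open>X\<close>, and the refinement hypothesis makes open sets
  of \<open>X\<close> open for \<open>f\<close>. The Hausdorff property turns the pseudometric into a metric: a point at
  distance \<open>0\<close> from \<open>x\<close> lies in every neighbourhood of \<open>x\<close>.\<close>

lemma AM_I:
  assumes X: "Hausdorff_space X" and f: "f \<in> bounded_pseudometrics X"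
    and ref: "balls_refine_topology X f"
  shows "f \<in> AM X"
proof -
  \<comment> \<open>The value \<open>0\<close> off the square keeps \<open>d\<close> nonnegative and symmetric on the whole type.\<close>
  define d where "d = (\<lambda>x y. if x \<in> topspace X \<and> y \<in> topspace X then f (x, y) else 0)"
  have fC: "f \<in> mspace (C_square X)"
    using f by (simp add: bounded_pseudometrics_def)
  have ps: "f (x, x) = 0" "f (x, y) = f (y, x)" "f (x, z) \<le> f (x, y) + f (y, z)"
    if "x \<in> topspace X" "y \<in> topspace X" "z \<in> topspace X" for x y z
    using f that unfolding bounded_pseudometrics_def by blast+
  have pos: "x = y" if xy: "x \<in> topspace X" "y \<in> topspace X" and 0: "f (x, y) = 0" for x y
  proof (rule ccontr)
    assume "x \<noteq> y"
    then obtain U where U: "openin X U" "x \<in> U" "y \<notin> U"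
      using X xy unfolding Hausdorff_space_def disjnt_iff by metis
    then obtain \<epsilon> where "\<epsilon> > 0" "\<forall>y\<in>topspace X. f (x, y) < \<epsilon> \<longrightarrow> y \<in> U"
      using ref unfolding balls_refine_topology_def by blast
    then show False using 0 xy U by auto
  qed
  interpret Metric_space "topspace X" d
  proof
    show "0 \<le> d x y" for x y
      using bounded_pseudometric_nonneg[OF f] by (auto simp: d_def)
    show "d x y = d y x" for x y
      using ps by (auto simp: d_def)
    show "d x y = 0 \<longleftrightarrow> x = y" if "x \<in> topspace X" "y \<in> topspace X" for x y
      using that pos ps by (auto simp: d_def)
    show "d x z \<le> d x y + d y z"
      if "x \<in> topspace X" "y \<in> topspace X" "z \<in> topspace X" for x y z
      using that ps by (auto simp: d_def)
  qed
  have "openin mtopology U \<longleftrightarrow> openin X U" for U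
  proof
    assume U: "openin mtopology U"
    show "openin X U"
    proof (subst openin_subopen, intro ballI)
      fix x assume "x \<in> U"
      then obtain r where r: "r > 0" "mball x r \<subseteq> U" and xX: "x \<in> topspace X"
        using U unfolding openin_mtopology by blast
      have "openin X {y \<in> topspace X. f (x, y) < r}"
        by (rule openin_ball_C_square[OF fC xX])
      moreover have "x \<in> {y \<in> topspace X. f (x, y) < r}"
        using xX r ps by simp
      moreover have "{y \<in> topspace X. f (x, y) < r} \<subseteq> U"
      proof
        fix y assume y: "y \<in> {y \<in> topspace X. f (x, y) < r}"
        then have "y \<in> mball x r" using xX by (simp add: in_mball) (simp add: d_def)
        then show "y \<in> U" using r by blast
      qed
      ultimately show "\<exists>T. openin X T \<and> x \<in> T \<and> T \<subseteq> U" by blast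
    qed
  next
    assume U: "openin X U"
    then have UX: "U \<subseteq> topspace X" by (rule openin_subset)
    show "openin mtopology U"
      unfolding openin_mtopology
    proof (intro conjI allI impI UX)
      fix x assume "x \<in> U"
      then obtain \<epsilon> where "\<epsilon> > 0" "\<forall>y\<in>topspace X. f (x, y) < \<epsilon> \<longrightarrow> y \<in> U"
        using ref U unfolding balls_refine_topology_def by blast
      then show "\<exists>r>0. mball x r \<subseteq> U"
      proof (intro exI[of _ \<epsilon>] conjI subsetI)
        fix y assume "y \<in> mball x \<epsilon>"
        then have "x \<in> topspace X" "y \<in> topspace X" "d x y < \<epsilon>"
          by (simp_all add: in_mball)
        moreover from this have "f (x, y) < \<epsilon>" by (simp add: d_def)
        ultimately show "y \<in> U"
          using \<open>\<forall>y\<in>topspace X. f (x, y) < \<epsilon> \<longrightarrow> y \<in> U\<close> by blast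
      qed
    qed
  qed
  then have "mtopology = X" by (simp add: topology_eq)
  then have adm: "admissible_metric X d"
    by (simp add: admissible_metric_def Metric_space_axioms)
  obtain B where "\<forall>p \<in> topspace X \<times> topspace X. \<bar>f p\<bar> \<le> B"
    using fC unfolding mspace_C_square bounded_iff by auto
  then have bdd: "\<forall>x \<in> topspace X. \<forall>y \<in> topspace X. d x y \<le> B"
    by (force simp: d_def)
  have "f = (\<lambda>(x, y) \<in> topspace X \<times> topspace X. d x y)"
  proof
    fix p show "f p = (\<lambda>(x, y) \<in> topspace X \<times> topspace X. d x y) p"
      using fC by (cases p) (auto simp: mspace_C_square d_def extensional_def restrict_def)
  qed
  with adm bdd show ?thesis
    unfolding AM_def by blast
qed

lemma AM_eq:
  assumes "Hausdorff_space X"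
  shows "AM X = {f \<in> bounded_pseudometrics X. balls_refine_topology X f}"
  using AM_I[OF assms] AM_subset_bounded_pseudometrics AM_balls_refine_topology by blast


section \<open>The ambient function space\<close>

lemma completely_metrizable_C_square: "completely_metrizable_space (mtopology_of (C_square X))"
proof -
  have "mcomplete_of (C_square X)"
    using Met_TC.mcomplete_cfunspace[where 'a = real, of "prod_topology X X"]
    by (simp add: C_square_def euclidean_metric_def Met_TC.Self_def complete_UNIV)
  then show ?thesis
    unfolding mtopology_of_def mcomplete_of_def
    by (rule Metric_space.completely_metrizable_space_mtopology[OF Metric_space_mspace_mdist])
qed

lemma C_square_abs_diff_le:
  assumes "f \<in> mspace (C_square X)" "g \<in> mspace (C_square X)"
    and "p \<in> topspace X \<times> topspace X"
  shows "\<bar>f p - g p\<bar> \<le> mdist (C_square X) f g"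
  using mdist_cfunspace_imp_mdist_le[of f "prod_topology X X" euclidean_metric g
      "mdist (C_square X) f g" p] assms
  by (simp add: C_square_def dist_real_def)

lemma openin_C_square:
  "openin (mtopology_of (C_square X)) S \<longleftrightarrow>
     S \<subseteq> mspace (C_square X) \<and>
     (\<forall>f\<in>S. \<exists>r>0. \<forall>g\<in>mspace (C_square X). mdist (C_square X) f g < r \<longrightarrow> g \<in> S)"
proof -
  interpret C: Metric_space "mspace (C_square X)" "mdist (C_square X)"
    by simp
  show ?thesis
    unfolding mtopology_of_def C.openin_mtopology C.mball_def by blast
qed

lemma continuous_map_evaluation:
  assumes "p \<in> topspace X \<times> topspace X"
  shows "continuous_map (mtopology_of (C_square X)) euclideanreal (\<lambda>f. f p)"
proof -
  have "\<exists>\<delta>>0. \<forall>g. g \<in> mspace (C_square X) \<and> mdist (C_square X) f g < \<delta> \<longrightarrow> dist (f p) (g p) < \<epsilon>"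
    if "f \<in> mspace (C_square X)" "\<epsilon> > 0" for f \<epsilon>
    using C_square_abs_diff_le[OF that(1) _ assms] that(2)
    by (intro exI[of _ \<epsilon>]) (fastforce simp: dist_real_def)
  then show ?thesis
    using Metric_space.metric_continuous_map[OF Metric_space_mspace_mdist[of "C_square X"]
        Met_TC.Metric_space_axioms, of "\<lambda>f. f p"]
    by (auto simp: mtopology_of_def)
qed

lemma closedin_bounded_pseudometrics:
  "closedin (mtopology_of (C_square X)) (bounded_pseudometrics X)"
proof -
  let ?C = "mtopology_of (C_square X)"
  define A where "A = (\<lambda>(x, y, z). {f \<in> topspace ?C. f (x, x) = 0} \<inter>
    {f \<in> topspace ?C. f (x, y) = f (y, x)} \<inter> {f \<in> topspace ?C. f (x, z) \<le> f (x, y) + f (y, z)})"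
  let ?I = "topspace X \<times> topspace X \<times> topspace X"
  have "closedin ?C (A t)" if "t \<in> ?I" for t
  proof -
    obtain x y z where t: "t = (x, y, z)" "x \<in> topspace X" "y \<in> topspace X" "z \<in> topspace X"
      using \<open>t \<in> ?I\<close> by (cases t) simp
    have ev: "continuous_map ?C euclideanreal (\<lambda>f. f (u, v))"
      if "u \<in> {x, y, z}" "v \<in> {x, y, z}" for u v
      using that t by (intro continuous_map_evaluation) auto
    have c1: "closedin ?C {f \<in> topspace ?C. f (x, x) \<in> {0}}"
      by (rule closedin_continuous_map_preimage[OF ev]) auto
    have c2: "closedin ?C {f \<in> topspace ?C. f (x, y) - f (y, x) \<in> {0}}"
      by (rule closedin_continuous_map_preimage[OF continuous_map_diff[OF ev ev]]) auto
    have c3: "closedin ?C {f \<in> topspace ?C. f (x, y) + f (y, z) - f (x, z) \<in> {0..}}"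
      by (rule closedin_continuous_map_preimage[OF continuous_map_diff[OF continuous_map_add[OF ev ev] ev]])
        auto
    show ?thesis
      using closedin_Int[OF closedin_Int[OF c1 c2] c3] by (simp add: A_def t)
  qed
  \<comment> \<open>The whole space is added because the family indexed by \<open>?I\<close> is empty if \<open>X\<close> is.\<close>
  then have "closedin ?C (\<Inter>(insert (topspace ?C) (A ` ?I)))"
    using closedin_topspace[of ?C] by (intro closedin_Inter) blast+
  also have "\<Inter>(insert (topspace ?C) (A ` ?I)) = bounded_pseudometrics X"
    unfolding bounded_pseudometrics_def A_def by fastforce
  finally show ?thesis .
qed


section \<open>Sigma-compact spaces\<close>

text \<open>The functions \<open>f\<close> that keep points at \<open>\<rho>\<close>-distance at least \<open>1 / (k + 1)\<close> apart, with a
  bound \<open>\<delta>\<close> uniform over \<open>x \<in> K\<close>. The uniformity is what makes this an open condition on \<open>f\<close>;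
  only \<open>x\<close> is confined to \<open>K\<close>, since points converging to \<open>x\<close> may come from all of \<open>X\<close>.\<close>

definition separating_on ::
    "'a topology \<Rightarrow> ('a \<Rightarrow> 'a \<Rightarrow> real) \<Rightarrow> 'a set \<Rightarrow> nat \<Rightarrow> ('a \<times> 'a \<Rightarrow> real) set" where
  "separating_on X \<rho> K k = {f \<in> mspace (C_square X).
    \<exists>\<delta>>0. \<forall>x\<in>K. \<forall>y\<in>topspace X. inverse (Suc k) \<le> \<rho> x y \<longrightarrow> \<delta> \<le> f (x, y)}"

text \<open>A function within \<open>\<delta>/2\<close> of \<open>f\<close> satisfies the same bounds with \<open>\<delta>/2\<close> in place of \<open>\<delta>\<close>.\<close>

lemma openin_separating_on:
  assumes "K \<subseteq> topspace X"
  shows "openin (mtopology_of (C_square X)) (separating_on X \<rho> K k)"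
  unfolding openin_C_square
proof (intro conjI ballI)
  fix f assume "f \<in> separating_on X \<rho> K k"
  then obtain \<delta> where f: "f \<in> mspace (C_square X)" and \<delta>: "\<delta> > 0"
    "\<And>x y. x \<in> K \<Longrightarrow> y \<in> topspace X \<Longrightarrow> inverse (Suc k) \<le> \<rho> x y \<Longrightarrow> \<delta> \<le> f (x, y)"
    unfolding separating_on_def by blast
  show "\<exists>r>0. \<forall>g\<in>mspace (C_square X). mdist (C_square X) f g < r \<longrightarrow> g \<in> separating_on X \<rho> K k"
  proof (intro exI[of _ "\<delta>/2"] conjI ballI impI)
    fix g assume g: "g \<in> mspace (C_square X)" "mdist (C_square X) f g < \<delta>/2"
    have "\<delta>/2 \<le> g (x, y)" if "x \<in> K" "y \<in> topspace X" "inverse (Suc k) \<le> \<rho> x y" for x y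
      using \<delta>(2)[OF that] C_square_abs_diff_le[OF f g(1), of "(x, y)"] g(2) that assms by auto
    then show "g \<in> separating_on X \<rho> K k"
      using g \<delta>(1) unfolding separating_on_def by (auto intro!: exI[of _ "\<delta>/2"])
  qed (use \<delta> in auto)
qed (auto simp: separating_on_def)

text \<open>A Lebesgue number argument: around each \<open>a \<in> K\<close> some \<open>f\<close>-ball of radius \<open>\<epsilon> a\<close> is
  \<open>\<rho>\<close>-small, and finitely many balls of half that radius cover \<open>K\<close>. If \<open>x \<in> K\<close> lies in the half
  ball around \<open>a\<close> and \<open>f (x, y)\<close> is below the least half radius, then \<open>x\<close> and \<open>y\<close> both lie in
  the full ball, so they are \<open>\<rho>\<close>-close.\<close>

lemma pseudometric_mem_separating_on:
  assumes K: "compactin (Metric_space.mtopology M \<rho>) K" and \<rho>: "Metric_space M \<rho>"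
    and f: "f \<in> bounded_pseudometrics (Metric_space.mtopology M \<rho>)"
    and ref: "balls_refine_topology (Metric_space.mtopology M \<rho>) f"
  shows "f \<in> separating_on (Metric_space.mtopology M \<rho>) \<rho> K k"
proof -
  interpret Metric_space M \<rho> by (rule \<rho>)
  let ?X = mtopology
  have fC: "f \<in> mspace (C_square ?X)"
    using f by (simp add: bounded_pseudometrics_def)
  have ps: "f (x, x) = 0" "f (x, y) = f (y, x)" "f (x, z) \<le> f (x, y) + f (y, z)"
    if "x \<in> M" "y \<in> M" "z \<in> M" for x y z
    using f that unfolding bounded_pseudometrics_def topspace_mtopology by blast+
  have KM: "K \<subseteq> M" using compactin_subset_topspace[OF K] by simp
  define s where "s = inverse (real (Suc k)) / 2"
  have s: "s > 0" by (simp add: s_def)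
  have "\<exists>\<epsilon>>0. \<forall>y\<in>M. f (a, y) < \<epsilon> \<longrightarrow> \<rho> a y < s" if "a \<in> M" for a
    using ref[unfolded balls_refine_topology_def, rule_format, of a "mball a s"] that s by auto
  then obtain \<epsilon> where \<epsilon>: "\<And>a. a \<in> M \<Longrightarrow> \<epsilon> a > 0"
    "\<And>a y. a \<in> M \<Longrightarrow> y \<in> M \<Longrightarrow> f (a, y) < \<epsilon> a \<Longrightarrow> \<rho> a y < s"
    by metis
  define V where "V = (\<lambda>a. {y \<in> M. f (a, y) < \<epsilon> a / 2})"
  have "openin ?X (V a)" if "a \<in> M" for a
    using openin_ball_C_square[OF fC, of a "\<epsilon> a / 2"] that by (simp add: V_def)
  moreover have "K \<subseteq> \<Union>(V ` K)"
  proof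
    fix x assume "x \<in> K"
    then have "x \<in> V x" using KM \<epsilon>(1) ps by (auto simp: V_def)
    with \<open>x \<in> K\<close> show "x \<in> \<Union>(V ` K)" by blast
  qed
  ultimately obtain \<F> where "finite \<F>" "\<F> \<subseteq> V ` K" "K \<subseteq> \<Union>\<F>"
    using compactinD[OF K, of "V ` K"] KM by blast
  then obtain A where A: "finite A" "A \<subseteq> K" "K \<subseteq> \<Union>(V ` A)"
    by (metis finite_subset_image)
  \<comment> \<open>The element \<open>1\<close> keeps the minimum meaningful when \<open>K\<close>, and hence \<open>A\<close>, is empty.\<close>
  define \<delta> where "\<delta> = Min (insert 1 ((\<lambda>a. \<epsilon> a / 2) ` A))"
  have \<delta>: "\<delta> > 0" "\<And>a. a \<in> A \<Longrightarrow> \<delta> \<le> \<epsilon> a / 2"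
  proof -
    show "\<delta> > 0" using A KM \<epsilon>(1) by (auto simp: \<delta>_def)
    show "\<delta> \<le> \<epsilon> a / 2" if "a \<in> A" for a
      unfolding \<delta>_def using A(1) that by (intro Min_le) auto
  qed
  have "\<delta> \<le> f (x, y)" if xy: "x \<in> K" "y \<in> M" "inverse (Suc k) \<le> \<rho> x y" for x y
  proof (rule ccontr)
    assume "\<not> \<delta> \<le> f (x, y)"
    obtain a where a: "a \<in> A" "x \<in> V a" using A xy by blast
    then have M: "a \<in> M" "x \<in> M" using A KM by (auto simp: V_def)
    have "f (a, x) < \<epsilon> a / 2" using a by (simp add: V_def)
    moreover have "f (x, y) < \<epsilon> a / 2" using \<open>\<not> \<delta> \<le> f (x, y)\<close> \<delta>(2)[OF a(1)] by linarith
    moreover have "f (a, y) \<le> f (a, x) + f (x, y)" using ps M xy by blast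
    ultimately have "\<rho> a x < s" "\<rho> a y < s"
      using \<epsilon>(1)[of a] \<epsilon>(2)[of a x] \<epsilon>(2)[of a y] M xy by auto
    moreover have "\<rho> x y \<le> \<rho> a x + \<rho> a y"
      using triangle'' M xy by metis
    ultimately show False using xy(3) by (simp add: s_def)
  qed
  then show ?thesis
    using fC \<delta>(1) unfolding separating_on_def by auto
qed

lemma gdelta_in_AM:
  assumes "metrizable_space X" "sigma_compact_space X"
  shows "gdelta_in (mtopology_of (C_square X)) (AM X)"
proof -
  let ?C = "mtopology_of (C_square X)"
  obtain M \<rho> where \<rho>: "Metric_space M \<rho>" and X: "X = Metric_space.mtopology M \<rho>"
    using assms(1) unfolding metrizable_space_def by blast
  interpret Metric_space M \<rho> by (rule \<rho>)
  from assms(2) obtain \<K>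
    where "countable \<K> \<and> (\<forall>K\<in>\<K>. compactin X K) \<and> \<Union>\<K> = topspace X"
    unfolding sigma_compact_space_def ..
  then have \<K>: "countable \<K>" "\<And>K. K \<in> \<K> \<Longrightarrow> compactin X K" "\<Union>\<K> = topspace X"
    by blast+
  define \<G> where "\<G> = insert (bounded_pseudometrics X)
    ((\<lambda>(K, k). separating_on X \<rho> K k) ` (\<K> \<times> UNIV))"
  have met: "metrizable_space ?C"
    by (simp add: completely_metrizable_C_square completely_metrizable_imp_metrizable_space)
  have "gdelta_in ?C (\<Inter>\<G>)"
  proof (rule gdelta_in_Inter)
    show "countable \<G>" using \<K>(1) by (simp add: \<G>_def)
    show "gdelta_in ?C S" if "S \<in> \<G>" for S
      using that closed_imp_gdelta_in[OF met closedin_bounded_pseudometrics]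
        open_imp_gdelta_in[OF openin_separating_on] compactin_subset_topspace[OF \<K>(2)]
      unfolding \<G>_def by fastforce
  qed (simp add: \<G>_def)
  also have "\<Inter>\<G> = AM X"
  proof -
    have "balls_refine_topology X f"
      if f: "f \<in> bounded_pseudometrics X" and sep: "\<And>K k. K \<in> \<K> \<Longrightarrow> f \<in> separating_on X \<rho> K k" for f
      unfolding balls_refine_topology_def
    proof (intro allI ballI impI)
      fix U x assume "x \<in> U" "openin X U"
      then obtain r where r: "r > 0" "mball x r \<subseteq> U" and xM: "x \<in> M"
        unfolding X openin_mtopology by blast
      obtain k where k: "inverse (Suc k) < r"
        using r(1) reals_Archimedean by blast
      obtain K where K: "K \<in> \<K>" "x \<in> K" using xM \<K>(3) X by auto
      obtain \<delta> where "\<delta> > 0" and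
        \<delta>: "\<And>y. y \<in> topspace X \<Longrightarrow> inverse (Suc k) \<le> \<rho> x y \<Longrightarrow> \<delta> \<le> f (x, y)"
        using sep[OF K(1), of k] K(2) unfolding separating_on_def by blast
      have "y \<in> U" if "y \<in> topspace X" "f (x, y) < \<delta>" for y
        using \<delta>[OF that(1)] that k r xM X by (fastforce simp: subset_iff)
      with \<open>\<delta> > 0\<close> show "\<exists>\<epsilon>>0. \<forall>y\<in>topspace X. f (x, y) < \<epsilon> \<longrightarrow> y \<in> U" by blast
    qed
    moreover have "f \<in> separating_on X \<rho> K k"
      if "f \<in> bounded_pseudometrics X" "balls_refine_topology X f" "K \<in> \<K>" for f K k
      using pseudometric_mem_separating_on[OF _ \<rho>] that \<K>(2) X by blast
    moreover have "f \<in> \<Inter>\<G> \<longleftrightarrow> f \<in> bounded_pseudometrics X \<and>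
        (\<forall>K\<in>\<K>. \<forall>k. f \<in> separating_on X \<rho> K k)" for f
      by (simp add: \<G>_def)
    ultimately show ?thesis
      unfolding AM_eq[OF metrizable_imp_Hausdorff_space[OF assms(1)]] by blast
  qed
  finally show ?thesis .
qed


section \<open>Gluing two points\<close>

text \<open>The quotient pseudometric obtained by identifying \<open>a\<close> and \<open>b\<close>: a shortest route from \<open>u\<close>
  to \<open>v\<close> is either direct or jumps once between \<open>a\<close> and \<open>b\<close>, in one of the two directions.\<close>

definition glue_dist :: "'b::metric_space \<Rightarrow> 'b \<Rightarrow> 'b \<Rightarrow> 'b \<Rightarrow> real" where
  "glue_dist a b u v = min (dist u v) (min (dist u a + dist b v) (dist u b + dist a v))"

lemma glue_dist_refl: "glue_dist a b u u = 0"
  by (simp add: glue_dist_def)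

lemma glue_dist_commute: "glue_dist a b u v = glue_dist a b v u"
  by (simp add: glue_dist_def dist_commute add.commute min.commute)

lemma glue_dist_nonneg: "0 \<le> glue_dist a b u v"
  by (simp add: glue_dist_def)

lemma glue_dist_le_dist: "glue_dist a b u v \<le> dist u v"
  by (simp add: glue_dist_def)

lemma glue_dist_triangle: "glue_dist a b u w \<le> glue_dist a b u v + glue_dist a b v w"
  unfolding glue_dist_def
  using dist_triangle[of u w v] dist_triangle[of u a v] dist_triangle[of u b v]
    dist_triangle[of b w v] dist_triangle[of a w v]
    dist_triangle[of u w a] dist_triangle[of u w b]
    zero_le_dist[of b v] zero_le_dist[of a v]
  by (simp add: min_def dist_commute split: if_splits; linarith)

lemma glue_dist_abs_diff_le: "\<bar>glue_dist a b u v - glue_dist a' b u v\<bar> \<le> dist a a'"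
  unfolding glue_dist_def
  using dist_triangle[of u a a'] dist_triangle[of u a' a] dist_triangle[of a v a']
    dist_triangle[of a' v a]
  by (simp add: min_def abs_le_iff dist_commute)


section \<open>A metrizable compactification\<close>

text \<open>The coordinates of the embedding are the distances, truncated at \<open>1\<close>, to the points \<open>q n\<close> of
  a dense sequence. It lands in the Hilbert cube \<open>[0,1]\<^sup>\<nat>\<close>, which is compact by Tychonoff.
  The topology can be read off the coordinates: a ball around \<open>x\<close> contains the set of points
  close to some \<open>q n\<close> that is itself close to \<open>x\<close>.\<close>

lemma separable_metrizable_embeds_in_compact:
  fixes X :: "'a topology"
  assumes "metrizable_space X" "separable_space X"
  obtains e :: "'a \<Rightarrow> nat \<Rightarrow> real"
    where "embedding_map X euclidean e" "compact (closure (e ` topspace X))"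
proof -
  obtain M \<rho> where \<rho>: "Metric_space M \<rho>" and X: "X = Metric_space.mtopology M \<rho>"
    using assms(1) unfolding metrizable_space_def by blast
  interpret Metric_space M \<rho> by (rule \<rho>)
  obtain Q where Q: "countable Q" "Q \<subseteq> M" "X closure_of Q = M"
    using assms(2) unfolding separable_space_def X by auto
  define q where "q = from_nat_into Q"
  \<comment> \<open>\<open>Q\<close> is empty only if \<open>X\<close> is; the value \<open>0\<close> then keeps \<open>e\<close> inside the cube.\<close>
  define e :: "'a \<Rightarrow> nat \<Rightarrow> real" where "e = (\<lambda>x n. if Q = {} then 0 else min 1 (\<rho> x (q n)))"
  have cont: "continuous_map X euclidean e"
  proof -
    have "continuous_map X euclideanreal (\<lambda>x. \<rho> x a)" if "a \<in> M" for a
    proof -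
      have "\<bar>\<rho> b a - \<rho> x a\<bar> \<le> \<rho> b x" if "b \<in> M" "x \<in> M" for b x
        using mdist_reverse_triangle[of b a x] \<open>a \<in> M\<close> that by (simp add: commute)
      then have "\<forall>b\<in>M. \<forall>\<epsilon>>0. \<exists>\<delta>>0. \<forall>x. x \<in> M \<and> \<rho> b x < \<delta> \<longrightarrow> dist (\<rho> b a) (\<rho> x a) < \<epsilon>"
        unfolding dist_real_def by (meson le_less_trans)
      then show ?thesis
        using metric_continuous_map[OF Met_TC.Metric_space_axioms, of "\<lambda>x. \<rho> x a"]
        by (simp add: X)
    qed
    then have "continuous_map X euclideanreal (\<lambda>x. e x n)" for n
      unfolding e_def q_def using from_nat_into[of Q n] Q(2)
      by (auto intro!: continuous_map_real_min)
    then have "continuous_map X (product_topology (\<lambda>_. euclideanreal) UNIV) e"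
      by (simp add: continuous_map_componentwise_UNIV)
    then show ?thesis
      by (simp only: euclidean_product_topology)
  qed
  have ref: "\<exists>W. open W \<and> e x \<in> W \<and> (\<forall>y\<in>M. e y \<in> W \<longrightarrow> y \<in> U)"
    if "x \<in> U" "openin X U" for x U
  proof -
    obtain r0 where r0: "r0 > 0" "mball x r0 \<subseteq> U" and xM: "x \<in> M"
      using \<open>x \<in> U\<close> \<open>openin X U\<close> unfolding X openin_mtopology by blast
    \<comment> \<open>A radius of at most \<open>1\<close> is not affected by the truncation of the coordinates.\<close>
    define r where "r = min 1 r0"
    have r: "r > 0" "r \<le> 1" "mball x r \<subseteq> U"
      using r0 by (auto simp: r_def subset_iff)
    have "x \<in> mtopology closure_of Q" using xM Q X by simp
    then have "\<forall>s>0. \<exists>a\<in>Q. a \<in> mball x s"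
      unfolding metric_closure_of by blast
    then obtain a where a: "a \<in> Q" "\<rho> x a < r/2"
      using r(1) by (metis half_gt_zero in_mball)
    obtain n where n: "q n = a"
      unfolding q_def using from_nat_into_surj[OF Q(1) a(1)] by blast
    let ?W = "{w :: nat \<Rightarrow> real. w n < r/2}"
    have "open ?W"
      by (intro open_Collect_less continuous_on_product_coordinates continuous_on_const)
    moreover have "e x \<in> ?W" using a n by (auto simp: e_def)
    moreover have "y \<in> U" if "y \<in> M" "e y \<in> ?W" for y
    proof -
      have "\<rho> y a < r/2" using that a n r by (auto simp: e_def min_def split: if_splits)
      moreover have "\<rho> x y \<le> \<rho> x a + \<rho> y a" using triangle' xM that a Q by blast
      ultimately have "\<rho> x y < r" using a by linarith
      then show ?thesis using r xM that by auto
    qed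
    ultimately show ?thesis by blast
  qed
  have "homeomorphic_map X (subtopology euclidean (e ` topspace X)) e"
  proof (rule bijective_open_imp_homeomorphic_map)
    show "continuous_map X (subtopology euclidean (e ` topspace X)) e"
      using cont by (simp add: continuous_map_in_subtopology)
    show "open_map X (subtopology euclidean (e ` topspace X)) e"
      unfolding open_map_def
    proof (intro allI impI)
      fix U assume U: "openin X U"
      then have UX: "U \<subseteq> M" using openin_subset X by fastforce
      show "openin (subtopology euclidean (e ` topspace X)) (e ` U)"
      proof (subst openin_subopen, intro ballI)
        fix w assume "w \<in> e ` U"
        then obtain x where x: "x \<in> U" "w = e x" by blast
        then obtain W where W: "open W" "e x \<in> W" "\<forall>y\<in>M. e y \<in> W \<longrightarrow> y \<in> U"
          using ref U by blast
        show "\<exists>T. openin (top_of_set (e ` topspace X)) T \<and> w \<in> T \<and> T \<subseteq> e ` U"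
          using W x UX X by (intro exI[of _ "e ` topspace X \<inter> W"]) (auto intro: openin_open_Int)
      qed
    qed
    show "inj_on e (topspace X)"
    proof (rule inj_onI, rule ccontr)
      fix x y assume xy: "x \<in> topspace X" "y \<in> topspace X" "e x = e y" "x \<noteq> y"
      then obtain U where "openin X U" "x \<in> U" "y \<notin> U"
        using metrizable_imp_Hausdorff_space[OF assms(1)]
        unfolding Hausdorff_space_def disjnt_iff by metis
      then show False using ref[of x U] xy X by auto
    qed
  qed auto
  then have emb: "embedding_map X euclidean e" by (simp add: embedding_map_def)
  let ?I = "PiE UNIV (\<lambda>_::nat. {0..1::real})"
  have "compactin (product_topology (\<lambda>_::nat. euclideanreal) UNIV) ?I"
    unfolding compactin_PiE by simp
  then have I: "compact ?I" by (simp add: euclidean_product_topology)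
  have "e ` topspace X \<subseteq> ?I" by (auto simp: e_def PiE_def)
  then have "closure (e ` topspace X) \<subseteq> ?I"
    using closure_minimal compact_imp_closed I by blast
  then have "compact (closure (e ` topspace X))"
    using compact_Int_closed[OF I closed_closure] by (metis inf.absorb_iff2)
  with emb that show ?thesis by blast
qed


section \<open>Pseudometrics that detect the points of the space\<close>

definition glued_pseudometric ::
    "'a topology \<Rightarrow> ('a \<Rightarrow> 'b::metric_space) \<Rightarrow> 'b \<Rightarrow> 'b \<Rightarrow> 'a \<times> 'a \<Rightarrow> real" where
  "glued_pseudometric X e p z = (\<lambda>(x, y) \<in> topspace X \<times> topspace X. glue_dist z p (e x) (e y))"

lemma glued_pseudometric_in_bounded_pseudometrics:
  fixes e :: "'a \<Rightarrow> 'b::metric_space"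
  assumes conte: "continuous_map X euclidean e" and bdd: "bounded (e ` topspace X)"
  shows "glued_pseudometric X e p z \<in> bounded_pseudometrics X"
proof -
  have "continuous_map (prod_topology X X) euclidean (\<lambda>q. glue_dist z p (e (fst q)) (e (snd q)))"
  proof -
    have "continuous_map (prod_topology X X) euclidean (e \<circ> fst)"
      "continuous_map (prod_topology X X) euclidean (e \<circ> snd)"
      using conte by (auto intro: continuous_map_compose continuous_map_fst continuous_map_snd)
    then show ?thesis
      unfolding glue_dist_def
      by (simp add: continuous_map_atin tendsto_dist tendsto_min tendsto_add o_def)
  qed
  then have "continuous_map (prod_topology X X) euclidean (glued_pseudometric X e p z)"
    by (rule continuous_map_eq) (auto simp: glued_pseudometric_def)
  moreover have "bounded (glued_pseudometric X e p z ` (topspace X \<times> topspace X))"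
  proof -
    define E where "E = e ` topspace X"
    obtain B where B: "\<And>u v. u \<in> E \<Longrightarrow> v \<in> E \<Longrightarrow> dist u v \<le> B"
      using bounded_two_points[THEN iffD1, OF bdd] unfolding E_def by metis
    have "\<bar>glued_pseudometric X e p z (x, y)\<bar> \<le> B" if "x \<in> topspace X" "y \<in> topspace X" for x y
      using that B[of "e x" "e y"] glue_dist_le_dist[of z p "e x" "e y"]
        glue_dist_nonneg[of z p "e x" "e y"] by (simp add: glued_pseudometric_def E_def)
    then show ?thesis unfolding bounded_iff by (intro exI[of _ B]) auto
  qed
  ultimately have "glued_pseudometric X e p z \<in> mspace (C_square X)"
    by (simp add: mspace_C_square glued_pseudometric_def)
  then show ?thesis
    unfolding bounded_pseudometrics_def
    by (auto simp: glued_pseudometric_def glue_dist_refl glue_dist_triangle) (rule glue_dist_commute)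
qed

text \<open>Moving the glued point from \<open>z\<close> to \<open>z'\<close> changes every distance by at most \<open>dist z z'\<close>, so the
  map into \<open>C_square X\<close> is 1-Lipschitz.\<close>

lemma continuous_map_glued_pseudometric:
  fixes e :: "'a \<Rightarrow> 'b::metric_space"
  assumes conte: "continuous_map X euclidean e" and bdd: "bounded (e ` topspace X)"
  shows "continuous_map euclidean (mtopology_of (C_square X)) (glued_pseudometric X e p)"
proof -
  let ?\<Phi> = "glued_pseudometric X e p"
  have "mdist (C_square X) (?\<Phi> z) (?\<Phi> z') \<le> dist z z'" for z z'
    unfolding C_square_def
    by (rule mdist_cfunspace_le)
      (auto simp: glued_pseudometric_def dist_real_def glue_dist_abs_diff_le)
  then have "\<forall>z. \<forall>\<epsilon>>0. \<exists>\<delta>>0. \<forall>z'. dist z z' < \<delta> \<longrightarrow>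
      mdist (C_square X) (?\<Phi> z) (?\<Phi> z') < \<epsilon>"
    by (meson le_less_trans)
  moreover have "range ?\<Phi> \<subseteq> mspace (C_square X)"
    using glued_pseudometric_in_bounded_pseudometrics[OF conte bdd]
    by (auto simp: bounded_pseudometrics_def)
  ultimately show ?thesis
    using Met_TC.metric_continuous_map[of "mspace (C_square X)" "mdist (C_square X)" ?\<Phi>]
    by (simp add: mtopology_of_def)
qed

text \<open>If \<open>z\<close> is outside the image of \<open>e\<close>, then so are both glued points, and gluing changes no
  sufficiently small distance from a given \<open>e x\<close>. If \<open>z = e x\<close>, any points of \<open>X\<close> whose
  images approach \<open>p\<close> become arbitrarily close to \<open>x\<close> while their images stay away from \<open>e x\<close>.
  The case \<open>z = p\<close>, where nothing is glued, falls under the first alternative.\<close>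

lemma glued_pseudometric_in_AM_iff:
  fixes e :: "'a \<Rightarrow> 'b::metric_space"
  assumes X: "Hausdorff_space X" and emb: "embedding_map X euclidean e"
    and bdd: "bounded (e ` topspace X)"
    and p: "p \<in> closure (e ` topspace X)" "p \<notin> e ` topspace X"
  shows "glued_pseudometric X e p z \<in> AM X \<longleftrightarrow> z \<notin> e ` topspace X"
proof -
  define E where "E = e ` topspace X"
  have hom: "homeomorphic_map X (top_of_set E) e"
    using emb by (simp add: embedding_map_def E_def)
  have conte: "continuous_map X euclidean e"
    using hom homeomorphic_imp_continuous_map continuous_map_in_subtopology by blast
  have ref_e: "\<exists>\<epsilon>>0. \<forall>y\<in>topspace X. dist (e x) (e y) < \<epsilon> \<longrightarrow> y \<in> U"
    if "x \<in> U" "openin X U" for x U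
  proof -
    have UX: "U \<subseteq> topspace X" using that openin_subset by blast
    have "openin (top_of_set E) (e ` U)"
      using hom that UX homeomorphic_map_openness by blast
    from openin_euclidean_subtopology_iff[THEN iffD1, OF this] imageI[OF \<open>x \<in> U\<close>, of e]
    obtain \<epsilon> where \<epsilon>: "\<epsilon> > 0" "\<And>w. w \<in> E \<Longrightarrow> dist w (e x) < \<epsilon> \<Longrightarrow> w \<in> e ` U"
      by metis
    have inj: "inj_on e (topspace X)"
      using hom homeomorphic_imp_injective_map by blast
    have "y \<in> U" if "y \<in> topspace X" "dist (e x) (e y) < \<epsilon>" for y
      using \<epsilon>(2)[of "e y"] that UX inj
      by (auto simp: dist_commute E_def inj_on_image_mem_iff)
    with \<epsilon>(1) show ?thesis by blast
  qed
  have outside: "glued_pseudometric X e p z \<in> AM X" if "z \<notin> E"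
  proof (rule AM_I[OF X glued_pseudometric_in_bounded_pseudometrics[OF conte bdd]])
    show "balls_refine_topology X (glued_pseudometric X e p z)"
      unfolding balls_refine_topology_def
    proof (intro allI ballI impI)
      fix U x assume xU: "x \<in> U" "openin X U"
      then have xX: "x \<in> topspace X" using openin_subset by blast
      obtain \<epsilon> where \<epsilon>: "\<epsilon> > 0" "\<And>y. y \<in> topspace X \<Longrightarrow> dist (e x) (e y) < \<epsilon> \<Longrightarrow> y \<in> U"
        using ref_e[OF xU] by blast
      \<comment> \<open>Any route that jumps must first leave \<open>e x\<close> for \<open>z\<close> or \<open>p\<close>, which costs at least \<open>\<eta>\<close>.\<close>
      define \<eta> where "\<eta> = min \<epsilon> (min (dist (e x) z) (dist (e x) p))"
      have "e x \<noteq> z" "e x \<noteq> p" using xX that p by (auto simp: E_def)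
      then have "\<eta> > 0" using \<epsilon> by (simp add: \<eta>_def)
      moreover have "y \<in> U" if y: "y \<in> topspace X" "glued_pseudometric X e p z (x, y) < \<eta>" for y
      proof -
        have "glue_dist z p (e x) (e y) < \<eta>" using y xX by (simp add: glued_pseudometric_def)
        then have "dist (e x) (e y) < \<epsilon>"
          using zero_le_dist[of p "e y"] zero_le_dist[of z "e y"]
          unfolding glue_dist_def \<eta>_def by linarith
        then show ?thesis using \<epsilon> y by blast
      qed
      ultimately
      show "\<exists>\<epsilon>>0. \<forall>y\<in>topspace X. glued_pseudometric X e p z (x, y) < \<epsilon> \<longrightarrow> y \<in> U"
        by blast
    qed
  qed
  have inside: "glued_pseudometric X e p z \<notin> AM X" if "z \<in> E"
  proof
    assume "glued_pseudometric X e p z \<in> AM X"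
    then have ref: "balls_refine_topology X (glued_pseudometric X e p z)"
      by (rule AM_balls_refine_topology)
    obtain x where x: "x \<in> topspace X" "z = e x" using \<open>z \<in> E\<close> by (auto simp: E_def)
    \<comment> \<open>With this radius the balls around \<open>z\<close> and \<open>p\<close> are disjoint.\<close>
    define r where "r = dist p z / 2"
    have r: "r > 0" using p \<open>z \<in> E\<close> by (auto simp: r_def E_def)
    define U where "U = {y \<in> topspace X. e y \<in> ball z r}"
    have "openin X U"
      unfolding U_def by (rule openin_continuous_map_preimage[OF conte]) simp
    moreover have "x \<in> U" using x r by (simp add: U_def)
    ultimately obtain \<epsilon>
      where \<epsilon>: "\<epsilon> > 0" "\<forall>y\<in>topspace X. glued_pseudometric X e p z (x, y) < \<epsilon> \<longrightarrow> y \<in> U"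
      using ref unfolding balls_refine_topology_def by blast
    obtain y where y: "y \<in> topspace X" "dist (e y) p < min \<epsilon> r"
      using p(1) \<epsilon>(1) r unfolding closure_approachable E_def
      by (metis imageE min_less_iff_conj)
    have "glued_pseudometric X e p z (x, y) \<le> dist p (e y)"
      using x y by (simp add: glued_pseudometric_def glue_dist_def)
    then have "y \<in> U" using \<epsilon>(2) y by (simp add: dist_commute)
    then have "dist z (e y) < r" by (simp add: U_def)
    then show False
      using y(2) dist_triangle[of p z "e y"] by (simp add: r_def dist_commute)
  qed
  show ?thesis using outside inside unfolding E_def by blast
qed

text \<open>If \<open>AM X\<close> is the intersection of the open sets \<open>G n\<close>, then the points \<open>z\<close> of the
  compactification whose glued pseudometric misses \<open>G n\<close> form a compact set \<open>T n\<close>, and these sets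
  together make up exactly the image of \<open>X\<close>.\<close>

lemma sigma_compact_if_gdelta_AM:
  fixes X :: "'a topology"
  assumes X: "metrizable_space X" "separable_space X"
    and AM: "gdelta_in (mtopology_of (C_square X)) (AM X)"
  shows "sigma_compact_space X"
proof -
  let ?C = "mtopology_of (C_square X)"
  obtain e :: "'a \<Rightarrow> nat \<Rightarrow> real"
    where emb: "embedding_map X euclidean e" and compY: "compact (closure (e ` topspace X))"
    using separable_metrizable_embeds_in_compact[OF X] .
  define E where "E = e ` topspace X"
  define Y where "Y = closure E"
  have Y: "compact Y" "E \<subseteq> Y" using compY closure_subset[of E] by (simp_all add: Y_def E_def)
  have hom: "homeomorphic_map X (top_of_set E) e"
    using emb by (simp add: embedding_map_def E_def)
  have conte: "continuous_map X euclidean e"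
    using hom homeomorphic_imp_continuous_map continuous_map_in_subtopology by blast
  have compactX: "compactin X {x \<in> topspace X. e x \<in> T}" if "compact T" "T \<subseteq> E" for T
  proof -
    have "e ` {x \<in> topspace X. e x \<in> T} = T" using that by (auto simp: E_def)
    then show ?thesis
      using that homeomorphic_map_compactness_eq[OF hom, of "{x \<in> topspace X. e x \<in> T}"]
      by (simp add: compactin_subtopology)
  qed
  show ?thesis
  proof (cases "Y = E")
    case True
    moreover have "{x \<in> topspace X. e x \<in> E} = topspace X" by (auto simp: E_def)
    ultimately have "compactin X (topspace X)" using compactX[of E] Y(1) by simp
    then show ?thesis
      unfolding sigma_compact_space_def by (intro exI[of _ "{topspace X}"]) simp
  next
    case False
    then obtain p where p: "p \<in> Y" "p \<notin> E" using Y by blast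
    define \<Phi> where "\<Phi> = glued_pseudometric X e p"
    have bdd: "bounded (e ` topspace X)"
      using Y compact_imp_bounded bounded_subset unfolding E_def by blast
    have \<Phi>_AM: "\<Phi> z \<in> AM X \<longleftrightarrow> z \<notin> E" for z
      using glued_pseudometric_in_AM_iff[OF metrizable_imp_Hausdorff_space[OF X(1)] emb bdd] p
      unfolding \<Phi>_def Y_def E_def by blast
    have cont\<Phi>: "continuous_map euclidean ?C \<Phi>"
      unfolding \<Phi>_def using conte bdd by (rule continuous_map_glued_pseudometric)
    obtain G :: "nat \<Rightarrow> ('a \<times> 'a \<Rightarrow> real) set"
      where G: "\<forall>n. openin ?C (G n)" "\<Inter>(range G) = AM X"
      using AM unfolding gdelta_in_descending by blast
    define T where "T n = {z \<in> Y. \<Phi> z \<notin> G n}" for n :: nat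
    have "compact (T n)" for n
    proof -
      have "openin euclidean {z \<in> topspace euclidean. \<Phi> z \<in> G n}"
        using cont\<Phi> G(1)[rule_format] by (rule openin_continuous_map_preimage)
      then have "closed (- {z. \<Phi> z \<in> G n})" by (simp add: closed_Compl)
      with Y(1) have "compact (Y \<inter> - {z. \<Phi> z \<in> G n})" by (rule compact_Int_closed)
      also have "Y \<inter> - {z. \<Phi> z \<in> G n} = T n" by (auto simp: T_def)
      finally show ?thesis .
    qed
    moreover have "T n \<subseteq> E" for n
      using \<Phi>_AM G(2) by (auto simp: T_def)
    ultimately have "compactin X {x \<in> topspace X. e x \<in> T n}" for n
      using compactX by blast
    moreover have "(\<Union>n. {x \<in> topspace X. e x \<in> T n}) = topspace X"
    proof -
      have "\<exists>n. e x \<in> T n" if "x \<in> topspace X" for x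
        using \<Phi>_AM[of "e x"] G(2) that Y(2) by (auto simp: T_def E_def)
      then show ?thesis by blast
    qed
    ultimately show ?thesis
      unfolding sigma_compact_space_def
      by (intro exI[of _ "range (\<lambda>n. {x \<in> topspace X. e x \<in> T n})"]) auto
  qed
qed

theorem corollary1:
  fixes X :: "'a topology"
  assumes "metrizable_space X" and "separable_space X"
  shows "sigma_compact_space X \<longleftrightarrow> completely_metrizable_space (AM_space X)"
proof -
  have "completely_metrizable_space (AM_space X) \<longleftrightarrow> gdelta_in (mtopology_of (C_square X)) (AM X)"
    unfolding AM_space_def
    by (rule completely_metrizable_space_eq_gdelta_in[OF completely_metrizable_C_square])
      (simp add: AM_subset_C_square)
  then show ?thesis
    using gdelta_in_AM[OF assms(1)] sigma_compact_if_gdelta_AM[OF assms] by blast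
qed

end
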